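(* Let $\chi$ be a probability distribution on $\mathbb{N}_0$ with $0\le\chi(0)<1$ and probability generating function $G(x)=\sum_{m=0}^{\infty}x^m\chi(m)$, and let $(p,q)\in[0,1]^2$ with $0<p+q<1$. Define $g_{p,q}:[0,1]\to[0,1]$ by $g_{p,q}(x)=(1-q)-(1-p-q)G(x)$ and let $g_{p,q}^{(2)}=g_{p,q}\circ g_{p,q}$. Let $\widetilde{w}=\widetilde{w}(p,q)$ be the probability that the site percolation game with parameter-pair $(p,q)$ on the rooted Galton-Watson tree $T_\chi$, starting with the token at the root $\phi$, is won by the player who plays the first round, and let $\widetilde{\ell}=\widetilde{\ell}(p,q)$ be the probability that it is lost by the player who plays the first round. Then: (1) $\widetilde{w}$ equals the minimum positive fixed point of $g_{p,q}^{(2)}$; (2) $\widetilde{\ell}=q+(1-p-q)G(\widetilde{w})$; (3) the probability that this game results in a draw is $0$ if and only if $g_{p,q}^{(2)}$ has a unique fixed point in $[0,1]$.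
   Context: $\mathbb{N}_0=\{0,1,2,\dots\}$. $T_\chi$ is the rooted Galton-Watson tree with root $\phi$ in which the numbers of children of the vertices are i.i.d. with law $\chi$. Each edge $\{u,v\}$ ($u$ the parent of $v$) is directed from $u$ to $v$. Site percolation game with parameter-pair $(p,q)$: given $T_\chi$, each vertex (including the root) is independently labeled trap with probability $p$, target with probability $q$, safe with probability $1-p-q$. The tree and all labels are revealed to both players (perfect information). Two players alternately move a token; a move takes the token from its current vertex $u$ along a directed edge to a child of $u$. A player who moves the token to a target vertex wins immediately; a player who moves it to a trap vertex loses immediately; a player whose turn it is to move when the token is at a safe leaf (childless vertex) loses. Convention for the starting vertex: if it is labeled trap, the game is won by the player who is to play the first round; if it is labeled target, the game is lost by the player who is to play the first round. If the game continues forever it is a draw. Both players play optimally: for a given realization, the game is won (respectively lost) by the first player if, under these rules, the first (respectively second) player has a strategy guaranteeing a win for herself in finitely many rounds against any play of the opponent; otherwise the game results in a draw. *)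

theory Defs
  imports "HOL-Probability.Probability"
begin

text \<open>
  Vertices are Ulam--Harris words over the naturals: the root is \<open>[]\<close> and the children of
  \<open>v\<close> are \<open>v @ [0], \<dots>, v @ [n - 1]\<close>, where \<open>n\<close> is the number of children of \<open>v\<close>.
  A realization assigns an offspring number and a label to every word; only the data on
  the words that belong to the tree are relevant. The offspring law is called \<open>\<nu>\<close>,
  as the letter chi is binder syntax in \<^theory>\<open>HOL-Analysis.Finite_Cartesian_Product\<close>.
\<close>

datatype label = Trap | Target | Safe

type_synonym vertex = "nat list"
type_synonym realization = "vertex \<Rightarrow> nat \<times> label"

definition label_at :: "realization \<Rightarrow> vertex \<Rightarrow> label" where
  "label_at \<omega> v = snd (\<omega> v)"

definition children :: "realization \<Rightarrow> vertex \<Rightarrow> vertex set" where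
  "children \<omega> v = (\<lambda>i. v @ [i]) ` {..<fst (\<omega> v)}"

inductive_set gw_tree :: "realization \<Rightarrow> vertex set" for \<omega> where
  root: "[] \<in> gw_tree \<omega>"
| child: "v \<in> gw_tree \<omega> \<Longrightarrow> u \<in> children \<omega> v \<Longrightarrow> u \<in> gw_tree \<omega>"

definition label_pmf :: "real \<Rightarrow> real \<Rightarrow> label pmf" where
  "label_pmf p q = embed_pmf (\<lambda>l. case l of Trap \<Rightarrow> p | Target \<Rightarrow> q | Safe \<Rightarrow> 1 - p - q)"

lemma pmf_label_pmf:
  assumes "0 \<le> p" "0 \<le> q" "p + q \<le> 1"
  shows "pmf (label_pmf p q) l = (case l of Trap \<Rightarrow> p | Target \<Rightarrow> q | Safe \<Rightarrow> 1 - p - q)"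
proof -
  have U: "(UNIV :: label set) = {Trap, Target, Safe}"
    by (auto intro: label.exhaust)
  show ?thesis
    unfolding label_pmf_def
  proof (rule pmf_embed_pmf)
    show "0 \<le> (case x of Trap \<Rightarrow> p | Target \<Rightarrow> q | Safe \<Rightarrow> 1 - p - q)" for x
      using assms by (cases x) auto
    show "(\<integral>\<^sup>+ x. ennreal (case x of Trap \<Rightarrow> p | Target \<Rightarrow> q | Safe \<Rightarrow> 1 - p - q)
             \<partial>count_space UNIV) = 1"
      using assms
      by (simp add: U nn_integral_count_space_finite ennreal_plus[symmetric] del: ennreal_plus)
  qed
qed

definition gw_measure :: "nat pmf \<Rightarrow> real \<Rightarrow> real \<Rightarrow> realization measure" where
  "gw_measure \<nu> p q =
     PiM (UNIV :: vertex set) (\<lambda>_. measure_pmf (pair_pmf \<nu> (label_pmf p q)))"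

datatype player = First | Second

fun opponent :: "player \<Rightarrow> player" where
  "opponent First = Second"
| "opponent Second = First"

definition to_move :: "vertex \<Rightarrow> player" where
  "to_move v = (if even (length v) then First else Second)"

definition game_over :: "realization \<Rightarrow> vertex \<Rightarrow> bool" where
  "game_over \<omega> v \<longleftrightarrow> label_at \<omega> v \<noteq> Safe \<or> children \<omega> v = {}"

text \<open>
  The player who moved the token to \<open>v\<close> is the opponent of the player to move at \<open>v\<close>.
  So at a trap the player to move wins, and at a target or a safe leaf this player loses.
  At the root this rule is the convention for the starting vertex.
\<close>

definition winner_at :: "realization \<Rightarrow> vertex \<Rightarrow> player" where
  "winner_at \<omega> v = (if label_at \<omega> v = Trap then to_move v else opponent (to_move v))"

text \<open>
  A vertex determines the path from the root to it, hence the whole history of the play,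
  so a strategy is a function of the current vertex. The realization is fixed, so a
  strategy may depend on the whole tree and all labels.
\<close>

definition strategy :: "realization \<Rightarrow> (vertex \<Rightarrow> vertex) \<Rightarrow> bool" where
  "strategy \<omega> \<sigma> \<longleftrightarrow> (\<forall>v\<in>gw_tree \<omega>. children \<omega> v \<noteq> {} \<longrightarrow> \<sigma> v \<in> children \<omega> v)"

text \<open>The token stays where it is once the game is over.\<close>

primrec play :: "realization \<Rightarrow> (player \<Rightarrow> vertex \<Rightarrow> vertex) \<Rightarrow> nat \<Rightarrow> vertex" where
  "play \<omega> s 0 = []"
| "play \<omega> s (Suc n) =
     (let v = play \<omega> s n in if game_over \<omega> v then v else s (to_move v) v)"

definition wins_play :: "realization \<Rightarrow> (player \<Rightarrow> vertex \<Rightarrow> vertex) \<Rightarrow> player \<Rightarrow> bool" where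
  "wins_play \<omega> s P \<longleftrightarrow>
     (\<exists>n. game_over \<omega> (play \<omega> s n) \<and> winner_at \<omega> (play \<omega> s n) = P)"

definition has_winning_strategy :: "realization \<Rightarrow> player \<Rightarrow> bool" where
  "has_winning_strategy \<omega> P \<longleftrightarrow>
     (\<exists>\<sigma>. strategy \<omega> \<sigma> \<and>
       (\<forall>\<tau>. strategy \<omega> \<tau> \<longrightarrow> wins_play \<omega> (\<lambda>Q. if Q = P then \<sigma> else \<tau>) P))"

definition win_prob :: "nat pmf \<Rightarrow> real \<Rightarrow> real \<Rightarrow> real" where
  "win_prob \<nu> p q = \<P>(\<omega> in gw_measure \<nu> p q. has_winning_strategy \<omega> First)"

definition loss_prob :: "nat pmf \<Rightarrow> real \<Rightarrow> real \<Rightarrow> real" where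
  "loss_prob \<nu> p q = \<P>(\<omega> in gw_measure \<nu> p q. has_winning_strategy \<omega> Second)"

definition draw_prob :: "nat pmf \<Rightarrow> real \<Rightarrow> real \<Rightarrow> real" where
  "draw_prob \<nu> p q =
     \<P>(\<omega> in gw_measure \<nu> p q. \<not> has_winning_strategy \<omega> First \<and> \<not> has_winning_strategy \<omega> Second)"

definition pgf :: "nat pmf \<Rightarrow> real \<Rightarrow> real" where
  "pgf \<nu> x = (\<Sum>m. x ^ m * pmf \<nu> m)"

text \<open>Only the values on \<open>{0..1}\<close>, which this function maps to itself when \<open>p\<close>, \<open>q\<close> and \<open>1 - p - q\<close> are nonnegative,
  are meaningful.\<close>

definition g_fun :: "nat pmf \<Rightarrow> real \<Rightarrow> real \<Rightarrow> real \<Rightarrow> real" where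
  "g_fun \<nu> p q x = (1 - q) - (1 - p - q) * pgf \<nu> x"

end

theory Submission imports Defs begin

text \<open>
  A player wins iff she can force a win within \<open>n\<close> rounds for some \<open>n\<close>, because the tree is locally
  finite. Let \<open>w n\<close> and \<open>l n\<close> be the probabilities that the first, respectively second, player
  can force a win within \<open>n\<close> steps. By independence of the subtrees at the children of the root,
  \<open>w (n + 1) = g (1 - l n)\<close> and \<open>1 - l (n + 1) = g (w n)\<close>, with \<open>w 0 = l 0 = 0\<close>. As \<open>g\<close> is continuous
  and decreasing, the limit of \<open>w\<close> is the least fixed point of \<open>g \<circ> g\<close> in the unit interval, and a
  draw has probability \<open>g w - w\<close>. This vanishes iff \<open>g \<circ> g\<close> has only one fixed point, since \<open>g\<close>
  maps fixed points of \<open>g \<circ> g\<close> to fixed points and reverses their order.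
\<close>

section \<open>Forced wins\<close>

text \<open>The horizon \<open>n\<close> counts visited vertices rather than moves: even a finished
  game needs \<open>n\<close> \<ge> 1. Replacing strategies by a recursion on \<open>n\<close> makes
  the winning events measurable and gives their probabilities recursively, starting from 0.\<close>

primrec forces :: "realization \<Rightarrow> player \<Rightarrow> nat \<Rightarrow> vertex \<Rightarrow> bool" where
  "forces \<omega> P 0 v \<longleftrightarrow> False"
| "forces \<omega> P (Suc n) v \<longleftrightarrow>
     (if game_over \<omega> v then winner_at \<omega> v = P
      else if to_move v = P then \<exists>c\<in>children \<omega> v. forces \<omega> P n c
      else \<forall>c\<in>children \<omega> v. forces \<omega> P n c)"

lemma finite_children [simp]: "finite (children \<omega> v)"
  by (simp add: children_def)

lemma forces_Suc: "forces \<omega> P n v \<Longrightarrow> forces \<omega> P (Suc n) v"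
proof (induction n arbitrary: v)
  case 0
  then show ?case by simp
next
  case (Suc n)
  show ?case
    using Suc.IH Suc.prems[unfolded forces.simps(2)[of \<omega> P n v]]
    unfolding forces.simps(2)[of \<omega> P "Suc n" v]
    by (auto simp del: forces.simps split: if_splits)
qed

lemma forces_mono: "m \<le> n \<Longrightarrow> forces \<omega> P m v \<Longrightarrow> forces \<omega> P n v"
  by (induction rule: dec_induct) (auto intro: forces_Suc simp del: forces.simps)

text \<open>If the players differ, one of them is to move and has a forced child; the other forces
  every child, hence also this one.\<close>

lemma forces_exclusive: "forces \<omega> P n v \<Longrightarrow> forces \<omega> Q n v \<Longrightarrow> P = Q"
proof (induction n arbitrary: v)
  case 0
  then show ?case by simp
next
  case (Suc n)
  show ?case
  proof (rule ccontr)
    assume "P \<noteq> Q"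
    then have "to_move v = P \<or> to_move v = Q"
      by (metis player.exhaust)
    moreover have "\<not> game_over \<omega> v"
      using Suc.prems \<open>P \<noteq> Q\<close> by auto
    moreover from this have "children \<omega> v \<noteq> {}"
      by (auto simp: game_over_def)
    ultimately show False
      using Suc.prems Suc.IH \<open>P \<noteq> Q\<close> by (auto split: if_splits)
  qed
qed

section \<open>Winning strategies versus forced wins\<close>

lemma play_in_gw_tree:
  assumes "\<And>P. strategy \<omega> (s P)"
  shows "play \<omega> s n \<in> gw_tree \<omega>"
proof (induction n)
  case 0
  then show ?case by (simp add: gw_tree.root)
next
  case (Suc n)
  then show ?case
    using assms by (auto simp: Let_def game_over_def strategy_def intro: gw_tree.child)
qed

text \<open>One choice of moves for all vertices, following the preference \<open>R\<close> wherever
  possible and legal everywhere else. It supplies both the winner's strategy and the opponent's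
  surviving one.\<close>

lemma obtain_move:
  obtains \<sigma> where "\<And>v. children \<omega> v \<noteq> {} \<Longrightarrow> \<sigma> v \<in> children \<omega> v"
    and "\<And>v c. c \<in> children \<omega> v \<Longrightarrow> R v c \<Longrightarrow> R v (\<sigma> v)"
proof -
  have "\<exists>c. (children \<omega> v \<noteq> {} \<longrightarrow> c \<in> children \<omega> v) \<and>
      ((\<exists>c\<in>children \<omega> v. R v c) \<longrightarrow> R v c)" for v
    by blast
  then obtain \<sigma> where "\<forall>v. (children \<omega> v \<noteq> {} \<longrightarrow> \<sigma> v \<in> children \<omega> v) \<and>
      ((\<exists>c\<in>children \<omega> v. R v c) \<longrightarrow> R v (\<sigma> v))"
    by metis
  with that show ?thesis by blast
qed

lemma has_winning_strategy_if_forces: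
  assumes "forces \<omega> P N []"
  shows "has_winning_strategy \<omega> P"
proof -
  \<comment> \<open>A strategy sees only the vertex, not the remaining horizon. It therefore aims at
    the least horizon, which is at most the remaining one.\<close>
  define rank where "rank v = (LEAST n. forces \<omega> P n v)" for v
  obtain \<sigma> where \<sigma>_child: "\<And>v. children \<omega> v \<noteq> {} \<Longrightarrow> \<sigma> v \<in> children \<omega> v"
    and \<sigma>_pref: "\<And>v c. c \<in> children \<omega> v \<Longrightarrow> forces \<omega> P (rank v - 1) c \<Longrightarrow>
      forces \<omega> P (rank v - 1) (\<sigma> v)"
    using obtain_move[of \<omega> "\<lambda>v. forces \<omega> P (rank v - 1)"] by blast
  have \<sigma>_forces: "forces \<omega> P n (\<sigma> v)"
    if v: "forces \<omega> P (Suc n) v" "\<not> game_over \<omega> v" "to_move v = P" for n v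
  proof -
    have least: "forces \<omega> P (rank v) v" "rank v \<le> Suc n"
      unfolding rank_def using v(1) by (rule LeastI, rule Least_le)
    then obtain m where m: "rank v = Suc m"
      by (cases "rank v") auto
    with least(1) v obtain c where "c \<in> children \<omega> v" "forces \<omega> P m c"
      by auto
    then have "forces \<omega> P m (\<sigma> v)" using \<sigma>_pref[of c v] m by simp
    then show ?thesis using least m forces_mono[of m n] by simp
  qed
  have \<sigma>: "strategy \<omega> \<sigma>"
    by (simp add: strategy_def \<sigma>_child)
  have "wins_play \<omega> (\<lambda>Q. if Q = P then \<sigma> else \<tau>) P" if \<tau>: "strategy \<omega> \<tau>" for \<tau>
  proof -
    let ?s = "\<lambda>Q. if Q = P then \<sigma> else \<tau>"
    have tree: "play \<omega> ?s k \<in> gw_tree \<omega>" for k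
      using \<sigma> \<tau> by (intro play_in_gw_tree) auto
    \<comment> \<open>Each move, by either player, lowers the remaining horizon by one, and horizon
      0 is impossible.\<close>
    have "wins_play \<omega> ?s P" if "forces \<omega> P n (play \<omega> ?s k)" for n k
      using that
    proof (induction n arbitrary: k)
      case 0
      then show ?case by simp
    next
      case (Suc n)
      let ?v = "play \<omega> ?s k"
      show ?case
      proof (cases "game_over \<omega> ?v")
        case True
        then show ?thesis using Suc.prems unfolding wins_play_def by auto
      next
        case False
        then have "children \<omega> ?v \<noteq> {}" by (simp add: game_over_def)
        then have "\<tau> ?v \<in> children \<omega> ?v"
          using \<tau> tree by (simp add: strategy_def)
        then have "forces \<omega> P n (play \<omega> ?s (Suc k))"
          using False Suc.prems \<sigma>_forces[OF Suc.prems False] by (auto simp: Let_def)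
        then show ?thesis by (rule Suc.IH)
      qed
    qed
    from this[of N 0] show ?thesis using assms by simp
  qed
  with \<sigma> show ?thesis unfolding has_winning_strategy_def by blast
qed

text \<open>Local finiteness enters here: the horizons of finitely many children have a maximum.
  Without children the claim is vacuous, whatever \<open>Max {}\<close> is.\<close>

lemma forces_if_children_forced:
  assumes "\<forall>c\<in>children \<omega> v. \<exists>n. forces \<omega> P n c"
  obtains N where "\<forall>c\<in>children \<omega> v. forces \<omega> P N c"
proof -
  from assms obtain r where r: "\<forall>c\<in>children \<omega> v. forces \<omega> P (r c) c"
    by metis
  have "forces \<omega> P (Max (r ` children \<omega> v)) c" if "c \<in> children \<omega> v" for c
    by (rule forces_mono[of "r c"]) (use r that in auto)
  with that show ?thesis by blast
qed

text \<open>The opponent survives by always moving to a child that \<open>P\<close> cannot force; for vertices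
  where all children are forced, finiteness of the number of children yields a common bound.\<close>

lemma forces_if_has_winning_strategy:
  assumes "has_winning_strategy \<omega> P"
  shows "\<exists>n. forces \<omega> P n []"
proof (rule ccontr)
  assume root: "\<nexists>n. forces \<omega> P n []"
  obtain \<tau> where \<tau>_child: "\<And>v. children \<omega> v \<noteq> {} \<Longrightarrow> \<tau> v \<in> children \<omega> v"
    and \<tau>_free: "\<And>v c. c \<in> children \<omega> v \<Longrightarrow> \<forall>n. \<not> forces \<omega> P n c \<Longrightarrow>
      \<forall>n. \<not> forces \<omega> P n (\<tau> v)"
    using obtain_move[of \<omega> "\<lambda>v c. \<forall>n. \<not> forces \<omega> P n c"] by blast
  have \<tau>: "strategy \<omega> \<tau>"
    by (simp add: strategy_def \<tau>_child)
  from assms obtain \<sigma> where \<sigma>: "strategy \<omega> \<sigma>"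
    and win: "\<And>\<tau>. strategy \<omega> \<tau> \<Longrightarrow> wins_play \<omega> (\<lambda>Q. if Q = P then \<sigma> else \<tau>) P"
    unfolding has_winning_strategy_def by blast
  let ?s = "\<lambda>Q. if Q = P then \<sigma> else \<tau>"
  have tree: "play \<omega> ?s k \<in> gw_tree \<omega>" for k
    using \<sigma> \<tau> by (intro play_in_gw_tree) auto
  \<comment> \<open>Invariant of the play: no vertex on it is forced for \<open>P\<close> at any
    horizon. A move of \<open>\<sigma>\<close> preserves this because a forced child would force the
    parent.\<close>
  have free: "\<not> forces \<omega> P n (play \<omega> ?s k)" for n k
  proof (induction k arbitrary: n)
    case 0
    then show ?case using root by simp
  next
    case (Suc k)
    let ?v = "play \<omega> ?s k"
    show ?case
    proof (cases "game_over \<omega> ?v")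
      case True
      then show ?thesis using Suc by (simp add: Let_def)
    next
      case False
      then have ne: "children \<omega> ?v \<noteq> {}" by (simp add: game_over_def)
      show ?thesis
      proof (cases "to_move ?v = P")
        case True
        have "\<sigma> ?v \<in> children \<omega> ?v"
          using \<sigma> tree ne by (simp add: strategy_def)
        with Suc[of "Suc n"] True False show ?thesis by (auto simp: Let_def)
      next
        case False
        have "\<exists>c\<in>children \<omega> ?v. \<forall>n. \<not> forces \<omega> P n c"
        proof (rule ccontr)
          assume "\<not> ?thesis"
          then obtain N where "\<forall>c\<in>children \<omega> ?v. forces \<omega> P N c"
            using forces_if_children_forced[of \<omega> ?v P] by blast
          with Suc[of "Suc N"] \<open>\<not> game_over \<omega> ?v\<close> False show False by simp
        qed
        then have "\<not> forces \<omega> P n (\<tau> ?v)" using \<tau>_free by blast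
        then show ?thesis
          using \<open>\<not> game_over \<omega> ?v\<close> False by (simp add: Let_def)
      qed
    qed
  qed
  from win[OF \<tau>] obtain k where "game_over \<omega> (play \<omega> ?s k)" "winner_at \<omega> (play \<omega> ?s k) = P"
    unfolding wins_play_def by blast
  \<comment> \<open>A finished game won by \<open>P\<close> is forced at horizon 1.\<close>
  with free[of "Suc 0" k] show False by simp
qed

lemma has_winning_strategy_iff_forces:
  "has_winning_strategy \<omega> P \<longleftrightarrow> (\<exists>n. forces \<omega> P n [])"
  using has_winning_strategy_if_forces forces_if_has_winning_strategy by blast

lemma not_both_win: "\<not> (has_winning_strategy \<omega> First \<and> has_winning_strategy \<omega> Second)"
proof
  assume "has_winning_strategy \<omega> First \<and> has_winning_strategy \<omega> Second"
  then obtain m n where "forces \<omega> First m []" "forces \<omega> Second n []"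
    by (auto simp: has_winning_strategy_iff_forces)
  then have "forces \<omega> First (max m n) []" "forces \<omega> Second (max m n) []"
    using forces_mono[of m "max m n"] forces_mono[of n "max m n"] by simp_all
  from forces_exclusive[OF this] show False by simp
qed

section \<open>Recursion at the root\<close>

text \<open>The shift is defined for every \<open>i\<close>, even if \<open>[i]\<close> is not a
  vertex of the tree, so its law does not involve the offspring number of the root.\<close>

definition subtree :: "nat \<Rightarrow> (nat list \<Rightarrow> 'a) \<Rightarrow> nat list \<Rightarrow> 'a" where
  "subtree i \<omega> = (\<lambda>v. \<omega> (i # v))"

lemma opponent_eq_iff: "opponent P = Q \<longleftrightarrow> P = opponent Q"
  by (cases P; cases Q) auto

lemma to_move_Cons: "to_move (i # v) = opponent (to_move v)"
  by (simp add: to_move_def)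

lemma children_Cons: "children \<omega> (i # v) = (#) i ` children (subtree i \<omega>) v"
  by (auto simp: children_def subtree_def)

lemma game_over_Cons: "game_over \<omega> (i # v) \<longleftrightarrow> game_over (subtree i \<omega>) v"
  by (simp add: game_over_def children_Cons) (simp add: label_at_def subtree_def)

lemma winner_at_Cons: "winner_at \<omega> (i # v) = opponent (winner_at (subtree i \<omega>) v)"
  by (simp add: winner_at_def to_move_Cons label_at_def subtree_def)

text \<open>Prefixing a letter changes the parity of the depth, so the two players swap roles in the
  subtree.\<close>

lemma forces_Cons: "forces \<omega> P n (i # v) \<longleftrightarrow> forces (subtree i \<omega>) (opponent P) n v"
  by (induction n arbitrary: v)
    (simp_all add: children_Cons game_over_Cons winner_at_Cons to_move_Cons opponent_eq_iff)

text \<open>The negated form gives both players' events the same shape, so one probability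
  computation serves both. A safe leaf is covered by the empty quantifier.\<close>

lemma forces_First_root:
  "forces \<omega> First (Suc n) [] \<longleftrightarrow> \<not> (snd (\<omega> []) = Target \<or> snd (\<omega> []) = Safe \<and>
     (\<forall>i<fst (\<omega> []). \<not> forces (subtree i \<omega>) Second n []))"
  by (cases "snd (\<omega> [])")
    (auto simp: game_over_def winner_at_def to_move_def label_at_def children_def forces_Cons)

lemma forces_Second_root:
  "forces \<omega> Second (Suc n) [] \<longleftrightarrow> snd (\<omega> []) = Target \<or> snd (\<omega> []) = Safe \<and>
     (\<forall>i<fst (\<omega> []). forces (subtree i \<omega>) First n [])"
  by (cases "snd (\<omega> [])")
    (auto simp: game_over_def winner_at_def to_move_def label_at_def children_def forces_Cons)

section \<open>Independence of the subtrees\<close>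

abbreviation iid_labels :: "'a pmf \<Rightarrow> (nat list \<Rightarrow> 'a) measure" where
  "iid_labels D \<equiv> PiM UNIV (\<lambda>_. measure_pmf D)"

lemma space_iid_labels [simp]: "space (iid_labels D) = UNIV"
  by (simp add: space_PiM PiE_def)

lemma prob_space_iid_labels: "prob_space (iid_labels D)"
  by (intro prob_space_PiM prob_space_measure_pmf)

lemma measurable_subtree [measurable]: "subtree i \<in> iid_labels D \<rightarrow>\<^sub>M iid_labels D"
  unfolding subtree_def by (intro measurable_PiM_single') auto

text \<open>The shift selects the coordinates along the injection \<open>Cons i\<close>, and all
  factors of the product are equal.\<close>

lemma distr_subtree: "distr (iid_labels D) (iid_labels D) (subtree i) = iid_labels D"
  using distr_PiM_reindex[of UNIV "\<lambda>_. measure_pmf D" "Cons i" UNIV]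
  by (simp add: prob_space_measure_pmf subtree_def[abs_def] restrict_def)

lemma distr_label: "distr (iid_labels D) (measure_pmf D) (\<lambda>\<omega>. \<omega> v) = measure_pmf D"
  using distr_PiM_component[of UNIV "\<lambda>_. measure_pmf D" v]
  by (simp add: prob_space_measure_pmf)

lemma indep_vars_iid_labels:
  "prob_space.indep_vars (iid_labels D) (\<lambda>_. measure_pmf D) (\<lambda>v \<omega>. \<omega> v) UNIV"
proof -
  interpret prob_space "iid_labels D" by (rule prob_space_iid_labels)
  show ?thesis
    by (subst indep_vars_iff_distr_eq_PiM')
      (auto simp: distr_label restrict_def)
qed

text \<open>The root and the subtrees read pairwise disjoint blocks of coordinates, so they are
  independent, and each subtree has the law of the whole.\<close>

lemma measure_root_subtrees:
  fixes D :: "'a pmf"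
  assumes Q: "{\<omega>. Q \<omega>} \<in> sets (iid_labels D)"
  shows "measure (iid_labels D) {\<omega>. \<omega> [] = a \<and> (\<forall>i<m. Q (subtree i \<omega>))} =
    pmf D a * measure (iid_labels D) {\<omega>. Q \<omega>} ^ m"
proof -
  interpret prob_space "iid_labels D" by (rule prob_space_iid_labels)
  \<comment> \<open>The block \<open>None\<close> is the root; the block \<open>Some i\<close>
    consists of the words starting with \<open>i\<close>.\<close>
  define K :: "nat option \<Rightarrow> nat list set" where
    "K = case_option {[]} (\<lambda>i. range (Cons i))"
  define A :: "nat option \<Rightarrow> (nat list \<Rightarrow> 'a) set" where
    "A = case_option {f \<in> space (PiM (K None) (\<lambda>_. measure_pmf D)). f [] = a}
       (\<lambda>i. {f \<in> space (PiM (K (Some i)) (\<lambda>_. measure_pmf D)). Q (subtree i f)})"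
  define X where "X j \<omega> = restrict \<omega> (K j)" for j and \<omega> :: "nat list \<Rightarrow> 'a"
  \<comment> \<open>The index \<open>None\<close> keeps \<open>J\<close> nonempty even for
    \<open>m\<close> = 0.\<close>
  define J where "J = insert None (Some ` {..<m})"
  have indep: "indep_vars (\<lambda>j. PiM (K j) (\<lambda>_. measure_pmf D)) X UNIV"
    unfolding X_def
    by (rule indep_vars_restrict[OF indep_vars_iid_labels])
      (auto simp: disjoint_family_on_def K_def split: option.splits)
  have A: "A j \<in> sets (PiM (K j) (\<lambda>_. measure_pmf D))" for j
  proof (cases j)
    case None
    have "(\<lambda>f. f []) \<in> PiM (K None) (\<lambda>_. measure_pmf D) \<rightarrow>\<^sub>M measure_pmf D"
      by (rule measurable_component_singleton) (simp add: K_def)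
    from measurable_sets[OF this, of "{a}"] show ?thesis
      by (simp add: A_def None vimage_def Int_def conj_commute)
  next
    case (Some i)
    have "subtree i \<in> PiM (K (Some i)) (\<lambda>_. measure_pmf D) \<rightarrow>\<^sub>M iid_labels D"
      unfolding subtree_def
      by (intro measurable_PiM_single' measurable_component_singleton) (auto simp: K_def)
    from measurable_sets[OF this Q] show ?thesis
      by (simp add: A_def Some vimage_def Int_def conj_commute)
  qed
  have X_None: "X None -` A None = {\<omega>. \<omega> [] = a}"
    by (auto simp: X_def A_def K_def space_PiM)
  have X_Some: "X (Some i) -` A (Some i) = {\<omega>. Q (subtree i \<omega>)}" for i
    by (auto simp: X_def A_def K_def space_PiM subtree_def)
  have root: "prob {\<omega>. \<omega> [] = a} = pmf D a"
  proof -
    have "pmf D a = measure (distr (iid_labels D) (measure_pmf D) (\<lambda>\<omega>. \<omega> [])) {a}"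
      by (simp add: distr_label measure_pmf_single)
    also have "\<dots> = prob {\<omega>. \<omega> [] = a}"
      by (simp add: measure_distr vimage_def)
    finally show ?thesis by simp
  qed
  have sub: "prob {\<omega>. Q (subtree i \<omega>)} = prob {\<omega>. Q \<omega>}" for i
  proof -
    have "prob {\<omega>. Q \<omega>} = measure (distr (iid_labels D) (iid_labels D) (subtree i)) {\<omega>. Q \<omega>}"
      by (simp add: distr_subtree)
    also have "\<dots> = prob {\<omega>. Q (subtree i \<omega>)}"
      using Q by (simp add: measure_distr vimage_def)
    finally show ?thesis by simp
  qed
  have "{\<omega>. \<omega> [] = a \<and> (\<forall>i<m. Q (subtree i \<omega>))} = (\<Inter>j\<in>J. X j -` A j \<inter> space (iid_labels D))"
    by (auto simp: J_def X_None X_Some)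
  also have "prob \<dots> = (\<Prod>j\<in>J. prob (X j -` A j \<inter> space (iid_labels D)))"
    by (rule indep_varsD[OF indep]) (auto simp: J_def A)
  also have "\<dots> = pmf D a * prob {\<omega>. Q \<omega>} ^ m"
    by (simp add: J_def X_None X_Some prod.reindex root sub)
  finally show ?thesis .
qed

section \<open>Generating functions\<close>

lemma sums_pmf_nat: "pmf \<nu> sums (1::real)" for \<nu> :: "nat pmf"
proof -
  have "(\<lambda>m. measure (measure_pmf \<nu>) {m}) sums measure (measure_pmf \<nu>) (\<Union>m. {m})"
    by (rule measure_pmf.finite_measure_UNION) (auto simp: disjoint_family_on_def)
  then show ?thesis by (simp add: measure_pmf_single)
qed

lemma pgf_term_le:
  assumes "x \<in> {0..1}"
  shows "x ^ m * pmf \<nu> m \<le> pmf \<nu> m"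
  using assms by (intro mult_left_le_one_le) (auto simp: power_le_one)

lemma summable_pgf:
  assumes "x \<in> {0..1}"
  shows "summable (\<lambda>m. x ^ m * pmf \<nu> m)"
proof (rule summable_comparison_test')
  show "summable (pmf \<nu>)" using sums_pmf_nat by (rule sums_summable)
  show "norm (x ^ m * pmf \<nu> m) \<le> pmf \<nu> m" for m
    using assms pgf_term_le[OF assms] by simp
qed

lemma pgf_mono:
  assumes "x \<in> {0..1}" "y \<in> {0..1}" "x \<le> y"
  shows "pgf \<nu> x \<le> pgf \<nu> y"
  unfolding pgf_def using assms
  by (intro suminf_le summable_pgf mult_right_mono power_mono) auto

lemma pgf_nonneg:
  assumes "x \<in> {0..1}"
  shows "0 \<le> pgf \<nu> x"
  unfolding pgf_def using assms by (intro suminf_nonneg summable_pgf) auto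

text \<open>On the unit interval \<open>x ^ m\<close> \<le> \<open>x\<close> for \<open>m\<close>
  \<ge> 1. The bound is the chord of the generating function between 0 and 1; if
  \<open>pmf \<nu> 0 < 1\<close>, it stays below 1 except at \<open>x\<close> = 1.\<close>

lemma pgf_le_chord:
  assumes "x \<in> {0..1}"
  shows "pgf \<nu> x \<le> pmf \<nu> 0 + x * (1 - pmf \<nu> 0)"
proof -
  have tail: "(\<lambda>m. pmf \<nu> (Suc m)) sums (1 - pmf \<nu> 0)"
    using sums_pmf_nat[of \<nu>] by (simp add: sums_Suc_iff)
  have "pgf \<nu> x = pmf \<nu> 0 + (\<Sum>m. x ^ Suc m * pmf \<nu> (Suc m))"
    unfolding pgf_def using suminf_split_head[OF summable_pgf[OF assms]] by simp
  also have "(\<Sum>m. x ^ Suc m * pmf \<nu> (Suc m)) \<le> (\<Sum>m. x * pmf \<nu> (Suc m))"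
  proof (rule suminf_le)
    show "summable (\<lambda>m. x ^ Suc m * pmf \<nu> (Suc m))"
      using summable_pgf[OF assms] by (subst summable_Suc_iff)
    show "summable (\<lambda>m. x * pmf \<nu> (Suc m))"
      using tail by (intro summable_mult) (rule sums_summable)
    show "x ^ Suc m * pmf \<nu> (Suc m) \<le> x * pmf \<nu> (Suc m)" for m
      using assms by (intro mult_right_mono) (auto simp: mult_left_le power_le_one)
  qed
  also have "\<dots> = x * (1 - pmf \<nu> 0)"
    using sums_mult[OF tail, of x] by (simp add: sums_iff)
  finally show ?thesis by simp
qed

lemma pgf_le_1:
  assumes "x \<in> {0..1}"
  shows "pgf \<nu> x \<le> 1"
proof -
  have "x * (1 - pmf \<nu> 0) \<le> 1 - pmf \<nu> 0"
    using assms by (intro mult_left_le_one_le) (auto simp: pmf_le_1)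
  with pgf_le_chord[OF assms, of \<nu>] show ?thesis by simp
qed

text \<open>The weights \<open>pmf \<nu> m\<close> are a summable majorant on the closed interval,
  so the partial sums converge uniformly up to the endpoint 1.\<close>

lemma continuous_on_pgf: "continuous_on {0..1} (pgf \<nu>)"
proof -
  have "uniform_limit {0..1} (\<lambda>n x. \<Sum>m<n. x ^ m * pmf \<nu> m) (\<lambda>x. \<Sum>m. x ^ m * pmf \<nu> m)
      sequentially"
  proof (rule Weierstrass_m_test)
    show "summable (pmf \<nu>)" using sums_pmf_nat by (rule sums_summable)
    show "norm (x ^ m * pmf \<nu> m) \<le> pmf \<nu> m" if "x \<in> {0..1}" for m and x :: real
      using that pgf_term_le[OF that] by simp
  qed
  then have "continuous_on {0..1} (\<lambda>x. \<Sum>m. x ^ m * pmf \<nu> m)"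
    by (rule uniform_limit_theorem[rotated])
      (auto intro!: always_eventually continuous_intros)
  then show ?thesis by (simp add: pgf_def[abs_def])
qed

section \<open>The recursion for the probabilities\<close>

context
  fixes \<nu> :: "nat pmf" and p q :: real
  assumes nonneg: "0 \<le> p" "0 \<le> q" and sum_le: "p + q \<le> 1"
begin

section \<open>The map g on the unit interval\<close>

lemma g_fun_in_unit:
  assumes "x \<in> {0..1}"
  shows "g_fun \<nu> p q x \<in> {0..1}"
proof -
  have "0 \<le> (1 - p - q) * pgf \<nu> x" "(1 - p - q) * pgf \<nu> x \<le> 1 - p - q"
    using pgf_nonneg[OF assms, of \<nu>] pgf_le_1[OF assms, of \<nu>] sum_le
    by (auto intro: mult_left_le)
  with nonneg show ?thesis by (auto simp: g_fun_def)
qed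

lemma g_fun_antimono:
  assumes "x \<in> {0..1}" "y \<in> {0..1}" "x \<le> y"
  shows "g_fun \<nu> p q y \<le> g_fun \<nu> p q x"
  using pgf_mono[OF assms, of \<nu>] sum_le by (simp add: g_fun_def mult_left_mono)

lemma continuous_on_g_fun: "continuous_on {0..1} (g_fun \<nu> p q)"
  unfolding g_fun_def[abs_def] by (intro continuous_intros continuous_on_pgf)

text \<open>A zero of \<open>g \<circ> g\<close> at \<open>0\<close> would force \<open>p = 0\<close> and \<open>G (g 0) = 1\<close>, hence \<open>g 0 = 1\<close> and
  then \<open>q = 0\<close>.\<close>

lemma g_fun_g_fun_0_neq_0:
  assumes "pmf \<nu> 0 < 1" "0 < p + q" "p + q < 1"
  shows "g_fun \<nu> p q (g_fun \<nu> p q 0) \<noteq> 0"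
proof
  let ?y = "g_fun \<nu> p q 0"
  assume zero: "g_fun \<nu> p q ?y = 0"
  have y: "?y \<in> {0..1}" by (rule g_fun_in_unit) simp
  have "(1 - p - q) * pgf \<nu> ?y \<le> 1 - p - q"
    using pgf_le_1[OF y, of \<nu>] sum_le by (intro mult_left_le) auto
  moreover have eq: "1 - q = (1 - p - q) * pgf \<nu> ?y"
    using zero unfolding g_fun_def[of _ _ _ ?y] by simp
  ultimately have "p = 0" using nonneg by simp
  with eq have "pgf \<nu> ?y = 1" using assms \<open>p = 0\<close> by simp
  \<comment> \<open>The chord bound at \<open>?y\<close>, where the generating function equals 1,
    rearranged.\<close>
  then have "(1 - ?y) * (1 - pmf \<nu> 0) \<le> 0"
    using pgf_le_chord[OF y, of \<nu>] by (simp add: algebra_simps)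
  then have "?y = 1" using assms y by (auto simp: mult_le_0_iff)
  moreover have "0 \<le> (1 - p - q) * pgf \<nu> 0"
    using sum_le pgf_nonneg[of 0 \<nu>] by simp
  ultimately have "q \<le> 0" by (simp add: g_fun_def)
  with \<open>p = 0\<close> assms show False by simp
qed

section \<open>Measurability of the forcing events\<close>

lemma gw_measure_eq_iid: "gw_measure \<nu> p q = iid_labels (pair_pmf \<nu> (label_pmf p q))"
  by (simp add: gw_measure_def)

interpretation gw: prob_space "gw_measure \<nu> p q"
  unfolding gw_measure_eq_iid by (rule prob_space_iid_labels)

lemma space_gw_measure [simp]: "space (gw_measure \<nu> p q) = UNIV"
  by (simp add: gw_measure_eq_iid)

lemma pred_sets: "Measurable.pred (gw_measure \<nu> p q) R \<Longrightarrow> {\<omega>. R \<omega>} \<in> sets (gw_measure \<nu> p q)"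
  by (simp add: pred_def)

lemma measurable_root: "(\<lambda>\<omega>. \<omega> []) \<in> gw_measure \<nu> p q \<rightarrow>\<^sub>M count_space UNIV"
proof -
  have "(\<lambda>\<omega>. \<omega> []) \<in> gw_measure \<nu> p q \<rightarrow>\<^sub>M measure_pmf (pair_pmf \<nu> (label_pmf p q))"
    unfolding gw_measure_eq_iid by (rule measurable_component_singleton) simp
  also have "(gw_measure \<nu> p q \<rightarrow>\<^sub>M measure_pmf (pair_pmf \<nu> (label_pmf p q))) =
      (gw_measure \<nu> p q \<rightarrow>\<^sub>M count_space UNIV)"
    by (rule measurable_cong_sets) simp_all
  finally show ?thesis .
qed

lemma measurable_root_snd_eq [measurable]:
  "Measurable.pred (gw_measure \<nu> p q) (\<lambda>\<omega>. snd (\<omega> []) = l)"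
  by (rule measurable_compose[OF measurable_root, of "\<lambda>x. snd x = l"]) simp

lemma measurable_root_less_fst [measurable]:
  "Measurable.pred (gw_measure \<nu> p q) (\<lambda>\<omega>. i < fst (\<omega> []))"
  by (rule measurable_compose[OF measurable_root, of "\<lambda>x. i < fst x"]) simp

lemma measurable_subtree_gw [measurable]: "subtree i \<in> gw_measure \<nu> p q \<rightarrow>\<^sub>M gw_measure \<nu> p q"
  unfolding gw_measure_eq_iid by (rule measurable_subtree)

text \<open>Induction on the horizon for both players at once, as the recursion at the root swaps
  them. The subtree events are preimages under the measurable shifts.\<close>

lemma measurable_forces_root [measurable]:
  "Measurable.pred (gw_measure \<nu> p q) (\<lambda>\<omega>. forces \<omega> P n [])"
proof (induction n arbitrary: P)
  case 0
  then show ?case by simp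
next
  case (Suc n)
  note [measurable] = Suc
  have [measurable]: "Measurable.pred (gw_measure \<nu> p q) (\<lambda>\<omega>. forces (subtree i \<omega>) Q n [])" for i Q
    by measurable
  show ?case
    by (cases P) (simp_all only: forces_First_root forces_Second_root, measurable)
qed

section \<open>One-step recursion for the probabilities\<close>

lemma measure_target_or_safe:
  assumes Q [measurable]: "Measurable.pred (gw_measure \<nu> p q) Q"
  shows "gw.prob {\<omega>. snd (\<omega> []) = Target \<or> snd (\<omega> []) = Safe \<and>
      (\<forall>i<fst (\<omega> []). Q (subtree i \<omega>))} = 1 - g_fun \<nu> p q (gw.prob {\<omega>. Q \<omega>})"
proof -
  let ?G = "gw_measure \<nu> p q"
  have [measurable]: "Measurable.pred ?G (\<lambda>\<omega>. Q (subtree i \<omega>))" for i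
    by measurable
  \<comment> \<open>The event is split by the offspring number and label of the root; only a safe
    root constrains the subtrees.\<close>
  define B where "B m l = {\<omega> \<in> space ?G. \<omega> [] = (m, l) \<and> (l = Safe \<longrightarrow> (\<forall>i<m. Q (subtree i \<omega>)))}" for m l
  have [measurable]: "Measurable.pred ?G (\<lambda>\<omega>. \<omega> [] = a)" for a
    by (rule measurable_compose[OF measurable_root, of "\<lambda>x. x = a"]) simp
  have B: "B m l \<in> sets ?G" for m l
    unfolding B_def by measurable
  \<comment> \<open>With exponent 0 the product formula leaves only the root probability.\<close>
  have B_Target: "gw.prob (B m Target) = q * pmf \<nu> m" for m
    using measure_root_subtrees[OF pred_sets[of "\<lambda>_. True", unfolded gw_measure_eq_iid],
        of "(m, Target)" 0] nonneg sum_le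
    by (simp add: B_def gw_measure_eq_iid pmf_pair pmf_label_pmf)
  have B_Safe: "gw.prob (B m Safe) = (1 - p - q) * (gw.prob {\<omega>. Q \<omega>} ^ m * pmf \<nu> m)" for m
    using measure_root_subtrees[OF pred_sets[OF Q, unfolded gw_measure_eq_iid],
        of "(m, Safe)" m] nonneg sum_le
    by (simp add: B_def gw_measure_eq_iid pmf_pair pmf_label_pmf)
  have "(\<lambda>m. gw.prob (B m Target \<union> B m Safe)) sums gw.prob (\<Union>m. B m Target \<union> B m Safe)"
  proof (rule gw.finite_measure_UNION)
    show "range (\<lambda>m. B m Target \<union> B m Safe) \<subseteq> gw.events"
      by (auto intro!: sets.Un B)
    show "disjoint_family (\<lambda>m. B m Target \<union> B m Safe)"
      by (auto simp: disjoint_family_on_def B_def)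
  qed
  moreover have "gw.prob (B m Target \<union> B m Safe) =
      q * pmf \<nu> m + (1 - p - q) * (gw.prob {\<omega>. Q \<omega>} ^ m * pmf \<nu> m)" for m
    unfolding B_Target[symmetric] B_Safe[symmetric]
    by (rule gw.finite_measure_Union[OF B B]) (auto simp: B_def)
  moreover have "(\<Union>m. B m Target \<union> B m Safe) = {\<omega>. snd (\<omega> []) = Target \<or> snd (\<omega> []) = Safe \<and>
      (\<forall>i<fst (\<omega> []). Q (subtree i \<omega>))}"
    by (auto simp: B_def prod_eq_iff)
  ultimately have "(\<lambda>m. q * pmf \<nu> m + (1 - p - q) * (gw.prob {\<omega>. Q \<omega>} ^ m * pmf \<nu> m)) sums
      gw.prob {\<omega>. snd (\<omega> []) = Target \<or> snd (\<omega> []) = Safe \<and> (\<forall>i<fst (\<omega> []). Q (subtree i \<omega>))}"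
    by simp
  moreover have "(\<lambda>m. q * pmf \<nu> m + (1 - p - q) * (gw.prob {\<omega>. Q \<omega>} ^ m * pmf \<nu> m)) sums
      (q * 1 + (1 - p - q) * pgf \<nu> (gw.prob {\<omega>. Q \<omega>}))"
    unfolding pgf_def
    by (intro sums_add sums_mult sums_pmf_nat summable_sums summable_pgf) simp
  ultimately show ?thesis
    by (simp add: g_fun_def sums_unique2)
qed

abbreviation force_prob :: "player \<Rightarrow> nat \<Rightarrow> real" where
  "force_prob P n \<equiv> gw.prob {\<omega>. forces \<omega> P n []}"

lemma prob_Not:
  assumes "Measurable.pred (gw_measure \<nu> p q) R"
  shows "gw.prob {\<omega>. \<not> R \<omega>} = 1 - gw.prob {\<omega>. R \<omega>}"
  using gw.prob_compl[OF pred_sets[OF assms]] by (simp add: set_diff_eq)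

lemma force_prob_Second_Suc: "force_prob Second (Suc n) = 1 - g_fun \<nu> p q (force_prob First n)"
  unfolding forces_Second_root by (rule measure_target_or_safe) measurable

text \<open>Complements are taken twice: once for the event at the root and once for the events in
  its subtrees.\<close>

lemma force_prob_First_Suc: "force_prob First (Suc n) = g_fun \<nu> p q (1 - force_prob Second n)"
proof -
  let ?R = "\<lambda>\<omega>. snd (\<omega> []) = Target \<or> snd (\<omega> []) = Safe \<and>
     (\<forall>i<fst (\<omega> []). \<not> forces (subtree i \<omega>) Second n [])"
  have [measurable]: "Measurable.pred (gw_measure \<nu> p q) (\<lambda>\<omega>. forces (subtree i \<omega>) P n [])" for i P
    by measurable
  have "force_prob First (Suc n) = gw.prob {\<omega>. \<not> ?R \<omega>}"
    unfolding forces_First_root ..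
  also have "\<dots> = 1 - gw.prob {\<omega>. ?R \<omega>}"
    by (rule prob_Not) measurable
  also have "\<dots> = g_fun \<nu> p q (gw.prob {\<omega>. \<not> forces \<omega> Second n []})"
    by (subst measure_target_or_safe[where Q="\<lambda>\<omega>. \<not> forces \<omega> Second n []"]) simp_all
  also have "gw.prob {\<omega>. \<not> forces \<omega> Second n []} = 1 - force_prob Second n"
    by (rule prob_Not) measurable
  finally show ?thesis .
qed

section \<open>Passage to the limit\<close>

lemma measurable_has_winning_strategy [measurable]:
  "Measurable.pred (gw_measure \<nu> p q) (\<lambda>\<omega>. has_winning_strategy \<omega> P)"
  unfolding has_winning_strategy_iff_forces by measurable

text \<open>Continuity from below: the events increase with the horizon and their union is the
  winning event.\<close>

lemma force_prob_tendsto: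
  "(\<lambda>n. force_prob P n) \<longlonglongrightarrow> gw.prob {\<omega>. has_winning_strategy \<omega> P}"
proof -
  have "(\<lambda>n. force_prob P n) \<longlonglongrightarrow> gw.prob (\<Union>n. {\<omega>. forces \<omega> P n []})"
  proof (rule gw.finite_Lim_measure_incseq)
    show "range (\<lambda>n. {\<omega>. forces \<omega> P n []}) \<subseteq> gw.events"
      using pred_sets[OF measurable_forces_root] by auto
    show "incseq (\<lambda>n. {\<omega>. forces \<omega> P n []})"
      by (auto simp: incseq_def intro: forces_mono)
  qed
  also have "(\<Union>n. {\<omega>. forces \<omega> P n []}) = {\<omega>. has_winning_strategy \<omega> P}"
    by (auto simp: has_winning_strategy_iff_forces)
  finally show ?thesis .
qed

lemma win_prob_eq: "win_prob \<nu> p q = gw.prob {\<omega>. has_winning_strategy \<omega> First}"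
  by (simp add: win_prob_def)

lemma loss_prob_eq: "loss_prob \<nu> p q = gw.prob {\<omega>. has_winning_strategy \<omega> Second}"
  by (simp add: loss_prob_def)

lemma win_prob_in_unit: "win_prob \<nu> p q \<in> {0..1}"
  by (simp add: win_prob_eq)

lemma loss_prob_in_unit: "loss_prob \<nu> p q \<in> {0..1}"
  by (simp add: loss_prob_eq)

lemma g_fun_tendsto:
  assumes "X \<longlonglongrightarrow> x" "x \<in> {0..1}" "\<And>n. X n \<in> {0..1}"
  shows "(\<lambda>n. g_fun \<nu> p q (X n)) \<longlonglongrightarrow> g_fun \<nu> p q x"
  by (rule continuous_on_tendsto_compose[OF continuous_on_g_fun assms(1,2)])
    (use assms(3) in auto)

lemma loss_prob_recursion: "loss_prob \<nu> p q = 1 - g_fun \<nu> p q (win_prob \<nu> p q)"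
proof (rule LIMSEQ_unique)
  show "(\<lambda>n. force_prob Second (Suc n)) \<longlonglongrightarrow> loss_prob \<nu> p q"
    using force_prob_tendsto[of Second] unfolding loss_prob_eq by (rule LIMSEQ_Suc)
  show "(\<lambda>n. force_prob Second (Suc n)) \<longlonglongrightarrow> 1 - g_fun \<nu> p q (win_prob \<nu> p q)"
    unfolding force_prob_Second_Suc using win_prob_in_unit
    by (intro tendsto_intros g_fun_tendsto) (auto simp: win_prob_eq intro: force_prob_tendsto)
qed

lemma win_prob_recursion: "win_prob \<nu> p q = g_fun \<nu> p q (1 - loss_prob \<nu> p q)"
proof (rule LIMSEQ_unique)
  show "(\<lambda>n. force_prob First (Suc n)) \<longlonglongrightarrow> win_prob \<nu> p q"
    using force_prob_tendsto[of First] unfolding win_prob_eq by (rule LIMSEQ_Suc)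
  show "(\<lambda>n. force_prob First (Suc n)) \<longlonglongrightarrow> g_fun \<nu> p q (1 - loss_prob \<nu> p q)"
    unfolding force_prob_First_Suc using loss_prob_in_unit
    by (intro g_fun_tendsto tendsto_intros) (auto simp: loss_prob_eq intro: force_prob_tendsto)
qed

lemma win_prob_fixed_point: "g_fun \<nu> p q (g_fun \<nu> p q (win_prob \<nu> p q)) = win_prob \<nu> p q"
  using win_prob_recursion loss_prob_recursion by simp

section \<open>Minimality, draws and uniqueness\<close>

lemma win_prob_le_fixed_point:
  assumes y: "y \<in> {0..1}" and fixed: "g_fun \<nu> p q (g_fun \<nu> p q y) = y"
  shows "win_prob \<nu> p q \<le> y"
proof -
  have gy: "g_fun \<nu> p q y \<in> {0..1}" using y by (rule g_fun_in_unit)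
  \<comment> \<open>Both bounds are carried together because each player's recursion uses the
    other's previous value.\<close>
  have "force_prob First n \<le> y \<and> g_fun \<nu> p q y \<le> 1 - force_prob Second n" for n
  proof (induction n)
    case 0
    then show ?case using y gy by simp
  next
    case (Suc n)
    then have "g_fun \<nu> p q (1 - force_prob Second n) \<le> g_fun \<nu> p q (g_fun \<nu> p q y)"
      using gy by (intro g_fun_antimono) auto
    moreover have "g_fun \<nu> p q y \<le> g_fun \<nu> p q (force_prob First n)"
      using Suc y by (intro g_fun_antimono) auto
    ultimately show ?case
      unfolding force_prob_First_Suc force_prob_Second_Suc using fixed by simp
  qed
  then show ?thesis
    unfolding win_prob_eq by (intro LIMSEQ_le_const2[OF force_prob_tendsto]) auto
qed

text \<open>The two winning events are disjoint, so a draw has the complementary probability, and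
  the loss probability is 1 minus g at the win probability.\<close>

lemma draw_prob_eq: "draw_prob \<nu> p q = g_fun \<nu> p q (win_prob \<nu> p q) - win_prob \<nu> p q"
proof -
  let ?W = "{\<omega>. has_winning_strategy \<omega> First}" and ?L = "{\<omega>. has_winning_strategy \<omega> Second}"
  have W: "?W \<in> gw.events" "?L \<in> gw.events"
    by (rule pred_sets, measurable)+
  have "draw_prob \<nu> p q = gw.prob (space (gw_measure \<nu> p q) - (?W \<union> ?L))"
    unfolding draw_prob_def by (rule arg_cong[where f=gw.prob]) auto
  also have "\<dots> = 1 - gw.prob (?W \<union> ?L)"
    using W by (intro gw.prob_compl) auto
  also have "gw.prob (?W \<union> ?L) = gw.prob ?W + gw.prob ?L"
    using W not_both_win by (intro gw.finite_measure_Union) auto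
  finally show ?thesis
    using loss_prob_recursion by (simp add: win_prob_eq loss_prob_eq)
qed

lemma unique_fixed_point_iff:
  "g_fun \<nu> p q (win_prob \<nu> p q) = win_prob \<nu> p q \<longleftrightarrow>
    (\<exists>!x. x \<in> {0..1} \<and> g_fun \<nu> p q (g_fun \<nu> p q x) = x)"
proof
  let ?g = "g_fun \<nu> p q" and ?w = "win_prob \<nu> p q"
  assume eq: "?g ?w = ?w"
  show "\<exists>!x. x \<in> {0..1} \<and> ?g (?g x) = x"
  proof (rule ex1I[of _ ?w], intro conjI win_prob_in_unit win_prob_fixed_point)
    fix y assume y: "y \<in> {0..1} \<and> ?g (?g y) = y"
    \<comment> \<open>The point \<open>?g y\<close> is again a fixed point of the second iterate, so
      minimality applies to it.\<close>
    then have "?w \<le> ?g y"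
      by (intro win_prob_le_fixed_point g_fun_in_unit) auto
    moreover have "?g y \<le> ?g ?w"
      using y win_prob_in_unit by (intro g_fun_antimono win_prob_le_fixed_point) auto
    ultimately have "?g y = ?w" using eq by simp
    with y eq show "y = ?w" by simp
  qed
next
  let ?g = "g_fun \<nu> p q" and ?w = "win_prob \<nu> p q"
  assume "\<exists>!x. x \<in> {0..1} \<and> ?g (?g x) = x"
  moreover have "?w \<in> {0..1} \<and> ?g (?g ?w) = ?w"
    using win_prob_in_unit win_prob_fixed_point by simp
  \<comment> \<open>A second fixed point of the iterate, which uniqueness identifies with
    \<open>?w\<close>.\<close>
  moreover have "?g ?w \<in> {0..1} \<and> ?g (?g (?g ?w)) = ?g ?w"
    using win_prob_in_unit win_prob_fixed_point g_fun_in_unit by simp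
  ultimately show "?g ?w = ?w" by blast
qed

end

theorem theorem1p2:
  fixes \<nu> :: "nat pmf" and p q :: real
  assumes "0 \<le> pmf \<nu> 0" and "pmf \<nu> 0 < 1"
    and "(p, q) \<in> {0..1} \<times> {0..1}"
    and "0 < p + q" and "p + q < 1"
  shows
    "(win_prob \<nu> p q \<in> {x \<in> {0..1}. 0 < x \<and> (g_fun \<nu> p q \<circ> g_fun \<nu> p q) x = x} \<and>
      (\<forall>x \<in> {x \<in> {0..1}. 0 < x \<and> (g_fun \<nu> p q \<circ> g_fun \<nu> p q) x = x}. win_prob \<nu> p q \<le> x)) \<and>
     loss_prob \<nu> p q = q + (1 - p - q) * pgf \<nu> (win_prob \<nu> p q) \<and>
     (draw_prob \<nu> p q = 0 \<longleftrightarrow>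
        (\<exists>!x. x \<in> {0..1} \<and> (g_fun \<nu> p q \<circ> g_fun \<nu> p q) x = x))"
proof -
  have pq: "0 \<le> p" "0 \<le> q" "p + q \<le> 1" using assms by auto
  note fixed = win_prob_fixed_point[OF pq, of \<nu>] and unit = win_prob_in_unit[OF pq, of \<nu>]
  \<comment> \<open>Minimality holds among all fixed points in the unit interval; excluding 0 makes
    the win probability the least positive one.\<close>
  have "win_prob \<nu> p q \<noteq> 0"
    using fixed g_fun_g_fun_0_neq_0[OF pq assms(2,4,5)] by auto
  then have "0 < win_prob \<nu> p q" using unit by simp
  moreover have "loss_prob \<nu> p q = q + (1 - p - q) * pgf \<nu> (win_prob \<nu> p q)"
    using loss_prob_recursion[OF pq, of \<nu>] by (simp add: g_fun_def)
  moreover have "draw_prob \<nu> p q = 0 \<longleftrightarrow>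
      (\<exists>!x. x \<in> {0..1} \<and> (g_fun \<nu> p q \<circ> g_fun \<nu> p q) x = x)"
    using draw_prob_eq[OF pq, of \<nu>] unique_fixed_point_iff[OF pq, of \<nu>] by simp
  ultimately show ?thesis
    using fixed unit win_prob_le_fixed_point[OF pq, of _ \<nu>] by auto
qed

end
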